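(* Let $G$ be a metric group of odd order $N=|G|$ and let $E\colon G\to\overline{\mathbb{Q}}$ be a finite quantum dilogarithm on $G$. Then $E(u)$ is a $2$-adic unit for every $u\in G$, i.e. $v(E(u))=0$ for every valuation $v$ of $\overline{\mathbb{Q}}$ extending the $2$-adic valuation of $\mathbb{Q}$.
   Context: Here $\overline{\mathbb{Q}}\subset\mathbb{C}$. A metric group is a finite abelian group $G$ together with a function $\langle\cdot\rangle\colon G\to\mathbb{C}^\times$ such that $\langle x\rangle=\langle -x\rangle$ for all $x$ and $\langle x;y\rangle:=\dfrac{\langle x+y\rangle}{\langle x\rangle\langle y\rangle}$ is a non-degenerate bicharacter on $G$. A finite quantum dilogarithm for a metric group $G$, $N=|G|$, is a function $E$ on $G$ such that for some non-zero constant $C$ and all $x,y\in G$, $$\langle x;y\rangle E(x)E(y)=C+\frac1{\sqrt N}\sum_{z\in G}E(y-z)E(z)\langle z\rangle E(x-z),$$ and which, when $|G|\le4$, is in addition required to satisfy $E(0)^2=\sqrt{N}\,E(0)+1$. *)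

theory Defs
  imports
    Complex_Main
    "HOL-Library.Cardinality"
    "HOL-Library.Extended_Real"
    "HOL-Computational_Algebra.Computational_Algebra"
begin

definition bichar :: "('a::ab_group_add \<Rightarrow> complex) \<Rightarrow> 'a \<Rightarrow> 'a \<Rightarrow> complex" where
  "bichar q x y = q (x + y) / (q x * q y)"

definition is_bicharacter :: "('a::ab_group_add \<Rightarrow> 'a \<Rightarrow> complex) \<Rightarrow> bool" where
  "is_bicharacter b \<longleftrightarrow>
     (\<forall>x y. b x y \<noteq> 0) \<and>
     (\<forall>x x' y. b (x + x') y = b x y * b x' y) \<and>
     (\<forall>x y y'. b x (y + y') = b x y * b x y')"

text \<open>
  Each one-sided condition says that the corresponding map from the group to its
  character group is injective, hence (the group being finite) bijective.
\<close>

definition nondegenerate :: "('a::ab_group_add \<Rightarrow> 'a \<Rightarrow> complex) \<Rightarrow> bool" where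
  "nondegenerate b \<longleftrightarrow>
     (\<forall>x. (\<forall>y. b x y = 1) \<longrightarrow> x = 0) \<and>
     (\<forall>y. (\<forall>x. b x y = 1) \<longrightarrow> y = 0)"

text \<open>The underlying finite abelian group is the whole type.\<close>

definition metric_group :: "('a::{finite, ab_group_add} \<Rightarrow> complex) \<Rightarrow> bool" where
  "metric_group q \<longleftrightarrow>
     (\<forall>x. q x \<noteq> 0) \<and>
     (\<forall>x. q (- x) = q x) \<and>
     is_bicharacter (bichar q) \<and>
     nondegenerate (bichar q)"

definition finite_quantum_dilog ::
  "('a::{finite, ab_group_add} \<Rightarrow> complex) \<Rightarrow> ('a \<Rightarrow> complex) \<Rightarrow> bool" where
  "finite_quantum_dilog q E \<longleftrightarrow>
     (\<exists>C. C \<noteq> 0 \<and>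
        (\<forall>x y. bichar q x y * E x * E y =
           C + 1 / complex_of_real (sqrt (real CARD('a))) *
                 (\<Sum>z\<in>UNIV. E (y - z) * E z * q z * E (x - z)))) \<and>
     (CARD('a) \<le> 4 \<longrightarrow>
        E 0 ^ 2 = complex_of_real (sqrt (real CARD('a))) * E 0 + 1)"

definition padic_val :: "int \<Rightarrow> rat \<Rightarrow> ereal" where
  "padic_val p r =
     (if r = 0 then \<infinity>
      else case quotient_of r of (a, b) \<Rightarrow>
        ereal (real (multiplicity p a) - real (multiplicity p b)))"

text \<open>
  The field of algebraic numbers is the subset of \<^typ>\<open>complex\<close> cut out by
  \<^const>\<open>algebraic\<close>; values of \<open>v\<close> outside it are irrelevant. Since this field is
  algebraic over the rationals, the value group of any valuation extending a
  \<open>p\<close>-adic one embeds into the reals, so taking real values is no restriction.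
\<close>

definition valuation_on_algebraic :: "(complex \<Rightarrow> ereal) \<Rightarrow> bool" where
  "valuation_on_algebraic v \<longleftrightarrow>
     (\<forall>x. algebraic x \<longrightarrow> v x \<noteq> -\<infinity>) \<and>
     (\<forall>x. algebraic x \<longrightarrow> (v x = \<infinity> \<longleftrightarrow> x = 0)) \<and>
     (\<forall>x y. algebraic x \<longrightarrow> algebraic y \<longrightarrow> v (x * y) = v x + v y) \<and>
     (\<forall>x y. algebraic x \<longrightarrow> algebraic y \<longrightarrow> v (x + y) \<ge> min (v x) (v y))"

definition extends_padic_val :: "int \<Rightarrow> (complex \<Rightarrow> ereal) \<Rightarrow> bool" where
  "extends_padic_val p v \<longleftrightarrow> (\<forall>r. v (of_rat r) = padic_val p r)"

end

theory Submission
  imports Defs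
begin

text \<open>
  Write \<open>h\<close> for the Fourier transform of \<open>E\<close> and \<open>r = \<surd>N\<close>. Transforming the five-term relation in
  one variable gives, for \<open>k \<noteq> 0\<close>,
  \<open>r E(y) h(y + k) \<langle>k\<rangle> = h(k) Q(y, k)\<close> with \<open>Q(y, k) = \<Sum>z. E(y - z) E(z) \<langle>z + k\<rangle>\<close>.
  Since \<open>C \<noteq> 0\<close>, \<open>h\<close> has no zeros; \<open>y = 0\<close> then yields the inversion relation
  \<open>E(x) E(-x) \<langle>x\<rangle> = \<kappa> + r E(0) \<delta>\<^sub>x\<close>, and the symmetry \<open>z \<mapsto> y - z\<close> of \<open>Q\<close> yields
  \<open>h(y) = c \<langle>y\<rangle> E(-y)\<close> for \<open>y \<noteq> 0\<close>. Transforming twice shows that \<open>\<kappa> = 1\<close> unless \<open>E\<close> is constant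
  away from \<open>0\<close>, which forces \<open>N \<le> 3\<close>. For \<open>y = 2a\<close>, \<open>k = -a\<close> the sum \<open>Q\<close> is invariant
  under the involution \<open>z \<mapsto> 2a - z\<close>, whose only fixed point is \<open>a\<close>, so
  \<open>r E(2a) E(-a) \<langle>a\<rangle> = E(a) (E(a)\<^sup>2 + 2 S)\<close> where \<open>S\<close> is a sum of products of two values of \<open>E\<close>. If
  the minimum \<open>m\<close> of \<open>v \<circ> E\<close> were negative and attained at \<open>a\<close>, then \<open>E(a)\<^sup>3\<close> would have
  valuation \<open>3m\<close> but all other terms valuation at least \<open>min (2m) (3m + 1)\<close>. So all values are
  integral at \<open>v\<close>, and the inversion relation makes them units.
\<close>

subsection \<open>Involutions and finite metric groups\<close>

lemma sum_UNIV_diff: "(\<Sum>z\<in>UNIV. f (c - z)) = (\<Sum>z\<in>(UNIV::'a::{finite,ab_group_add} set). f z)"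
  by (rule sum.reindex_bij_witness[of _ "\<lambda>z. c - z" "\<lambda>z. c - z"]) auto

lemma sum_UNIV_add: "(\<Sum>z\<in>UNIV. f (z + c)) = (\<Sum>z\<in>(UNIV::'a::{finite,ab_group_add} set). f z)"
  by (rule sum.reindex_bij_witness[of _ "\<lambda>z. z - c" "\<lambda>z. z + c"]) auto

text \<open>Induction on the cardinality, removing one orbit \<open>{a, i a}\<close> at a time;
  \<open>B\<close> holds one representative per orbit.\<close>

lemma involution_half:
  assumes "finite A" and "\<And>z. z \<in> A \<Longrightarrow> i z \<in> A \<and> i z \<noteq> z \<and> i (i z) = z"
  shows "\<exists>B\<subseteq>A. B \<inter> i ` B = {} \<and> A = B \<union> i ` B \<and> inj_on i B"
  using assms
proof (induction "card A" arbitrary: A rule: less_induct)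
  case less
  show ?case
  proof (cases "A = {}")
    case False
    then obtain a where a: "a \<in> A" by blast
    have ia: "i a \<in> A" "i a \<noteq> a" "i (i a) = a" using less.prems(2)[OF a] by auto
    have "card (A - {a, i a}) < card A"
      using less.prems(1) a by (intro psubset_card_mono) auto
    moreover have "i z \<in> A - {a, i a} \<and> i z \<noteq> z \<and> i (i z) = z" if "z \<in> A - {a, i a}" for z
      using that less.prems(2)[of z] ia by auto
    ultimately obtain B where B: "B \<subseteq> A - {a, i a}" "B \<inter> i ` B = {}"
        "A - {a, i a} = B \<union> i ` B" "inj_on i B"
      using less.hyps[of "A - {a, i a}"] less.prems(1) by blast
    have "i ` B \<subseteq> A - {a, i a}" using B by auto
    then have "insert a B \<inter> i ` insert a B = {}" "inj_on i (insert a B)"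
      using B ia by auto
    moreover have "A = insert a B \<union> i ` insert a B" using B(3) a ia by auto
    ultimately show ?thesis using B(1) a by (intro exI[of _ "insert a B"]) auto
  qed auto
qed

text \<open>Paired terms agree, hence the factor 2 that later raises valuations. The semiring
  setting also covers counting in the naturals.\<close>

lemma sum_involution:
  fixes f :: "'b \<Rightarrow> 'c::semiring_1"
  assumes "finite A" and "\<And>z. z \<in> A \<Longrightarrow> i z \<in> A \<and> i z \<noteq> z \<and> i (i z) = z"
    and f: "\<And>z. z \<in> A \<Longrightarrow> f (i z) = f z"
  shows "\<exists>B\<subseteq>A. sum f A = 2 * sum f B"
proof -
  obtain B where B: "B \<subseteq> A" "B \<inter> i ` B = {}" "A = B \<union> i ` B" "inj_on i B"
    using involution_half[OF assms(1,2)] by blast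
  have fin: "finite B" using B(1) assms(1) by (rule finite_subset)
  have "sum f A = sum f B + sum f (i ` B)"
    using B fin by (subst B(3)) (intro sum.union_disjoint, auto)
  also have "sum f (i ` B) = sum f B"
    using B f by (subst sum.reindex) (auto intro!: sum.cong)
  finally show ?thesis using B(1) by (auto simp: mult_2)
qed

text \<open>A nonzero \<open>x\<close> with \<open>x + x = 0\<close> would make translation by
  \<open>x\<close> a fixed-point-free involution, so the order would be even.\<close>

lemma odd_card_double_eq_0:
  fixes x :: "'a::{finite,ab_group_add}"
  assumes "odd CARD('a)" "x + x = 0"
  shows "x = 0"
proof (rule ccontr)
  assume "x \<noteq> 0"
  then obtain B :: "'a set" where "(\<Sum>z\<in>(UNIV::'a set). 1::nat) = 2 * (\<Sum>z\<in>B. 1)"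
    using assms(2) sum_involution[of "UNIV::'a set" "\<lambda>z. x + z" "\<lambda>_. 1::nat"]
    by (force simp: add.assoc[symmetric])
  then show False using assms(1) by auto
qed

locale finite_metric_group =
  fixes q :: "'a::{finite, ab_group_add} \<Rightarrow> complex"
  assumes mg: "metric_group q"
begin

abbreviation b where "b \<equiv> bichar q"

lemma q_nonzero [simp]: "q x \<noteq> 0" using mg by (simp add: metric_group_def)
lemma q_minus [simp]: "q (- x) = q x" using mg by (simp add: metric_group_def)
lemma b_nonzero [simp]: "b x y \<noteq> 0" by (simp add: bichar_def)
lemma b_add_left: "b (x + x') y = b x y * b x' y"
  using mg unfolding metric_group_def is_bicharacter_def by blast
lemma b_add_right: "b x (y + y') = b x y * b x y'"
  using mg unfolding metric_group_def is_bicharacter_def by blast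
lemma b_commute: "b x y = b y x" by (simp add: bichar_def ac_simps)
lemma b_0_left [simp]: "b 0 y = 1" using b_add_left[of 0 0 y] by simp
lemma b_0_right [simp]: "b y 0 = 1" using b_add_right[of y 0 0] by simp
lemma b_minus_left: "b (- x) y = inverse (b x y)"
  using b_add_left[of x "- x" y] by (simp add: inverse_unique)
lemma b_minus_right: "b x (- y) = inverse (b x y)"
  using b_add_right[of x y "- y"] by (simp add: inverse_unique)
lemma q_add: "q (x + y) = b x y * q x * q y" by (simp add: bichar_def)
lemma q_0 [simp]: "q 0 = 1" using q_add[of 0 0] by simp
lemma q_diff: "q (x - y) = q x * q y / b x y"
  using q_add[of x "- y"] by (simp add: b_minus_right divide_inverse ac_simps)
lemma b_self: "b x x = q x ^ 2"
  using q_diff[of x x] by (simp add: power2_eq_square)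

section \<open>Character orthogonality and Fourier inversion\<close>

lemma sum_bichar: "(\<Sum>x\<in>UNIV. b x k) = (if k = 0 then of_nat CARD('a) else 0)"
proof (cases "k = 0")
  case False
  then obtain c where c: "b c k \<noteq> 1"
    using mg unfolding metric_group_def nondegenerate_def by blast
  \<comment> \<open>Translation by \<open>c\<close> multiplies the sum by \<open>b c k\<close>,
    which is not 1, so the sum vanishes.\<close>
  have "(\<Sum>x\<in>UNIV. b x k) = (\<Sum>x\<in>UNIV. b (x + c) k)" by (rule sum_UNIV_add[symmetric])
  also have "\<dots> = (\<Sum>x\<in>UNIV. b x k) * b c k" by (simp add: b_add_left sum_distrib_right)
  finally show ?thesis using c False by simp
qed simp

definition fourier :: "('a \<Rightarrow> complex) \<Rightarrow> 'a \<Rightarrow> complex" where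
  "fourier f k = (\<Sum>x\<in>UNIV. b x k * f x)"

lemma fourier_fourier: "fourier (fourier f) k = of_nat CARD('a) * f (- k)"
proof -
  have "fourier (fourier f) k = (\<Sum>j\<in>UNIV. \<Sum>x\<in>UNIV. f x * b j (x + k))"
    by (simp add: fourier_def sum_distrib_left b_add_right b_commute ac_simps)
  also have "\<dots> = (\<Sum>x\<in>UNIV. \<Sum>j\<in>UNIV. f x * b j (x + k))" by (rule sum.swap)
  also have "\<dots> = (\<Sum>x\<in>UNIV. if x = - k then of_nat CARD('a) * f x else 0)"
    by (intro sum.cong) (auto simp: sum_distrib_left[symmetric] sum_bichar eq_neg_iff_add_eq_0)
  finally show ?thesis by simp
qed

lemma fourier_inject:
  assumes "\<And>k. fourier f k = fourier g k"
  shows "f x = g x"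
proof -
  have "of_nat CARD('a) * f x = of_nat CARD('a) * g x"
    using fourier_fourier[of f "- x"] fourier_fourier[of g "- x"] assms by (simp add: fourier_def)
  then show ?thesis by simp
qed

lemma fourier_const_delta: "fourier (\<lambda>x. a + (if x = 0 then c else 0)) k = (if k = 0 then of_nat CARD('a) * a else 0) + c"
proof -
  have "fourier (\<lambda>x. a + (if x = 0 then c else 0)) k
     = (\<Sum>x\<in>UNIV. b x k * a + (if x = 0 then c else 0))"
    unfolding fourier_def by (intro sum.cong) (auto simp: algebra_simps)
  also have "\<dots> = (\<Sum>x\<in>UNIV. b x k) * a + c" by (simp add: sum.distrib sum_distrib_right)
  finally show ?thesis by (simp add: sum_bichar)
qed

text \<open>Multiples of \<open>x\<close> repeat in a finite group, so \<open>b x x\<close>, the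
  square of \<open>q x\<close>, is a root of unity.\<close>

lemma q_root_of_unity: "\<exists>m>0. q x ^ m = 1"
proof -
  define s where "s k = ((+) x ^^ k) 0" for k
  have bs: "b (s k) x = b x x ^ k" for k
    by (induction k) (auto simp: s_def b_add_left)
  have "\<not> inj s"
    using finite_UNIV by (metis finite_imageD finite_subset infinite_UNIV_nat subset_UNIV finite)
  then obtain i j where ij: "i < j" "s i = s j"
    unfolding inj_def by (metis linorder_neqE_nat)
  have "b x x ^ j = b x x ^ i * b x x ^ (j - i)" using ij by (simp add: power_add[symmetric])
  moreover have "b x x ^ i = b x x ^ j" using bs[of i] bs[of j] ij by simp
  ultimately have "b x x ^ (j - i) = 1" by simp
  then have "q x ^ (2 * (j - i)) = 1" by (simp add: b_self power_mult)
  then show ?thesis using ij by (intro exI[of _ "2 * (j - i)"]) auto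
qed

text \<open>For \<open>y\<close> outside \<open>{0, x, - x}\<close> both \<open>x + y\<close> and
  \<open>x - y\<close> are nonzero, which forces \<open>b x y = c\<close> and
  \<open>c ^ 2 = 1\<close>; doubling \<open>x\<close> then gives \<open>c = 1\<close>, against
  nondegeneracy.\<close>

lemma card_le_3_if_q_const:
  assumes odd: "odd CARD('a)" and c: "\<And>x. x \<noteq> 0 \<Longrightarrow> q x = c"
  shows "CARD('a) \<le> 3"
proof (rule ccontr)
  assume "\<not> ?thesis"
  then have card: "CARD('a) > 3" by simp
  have "\<not> (UNIV::'a set) \<subseteq> {0}" using card card_mono[of "{0}" "UNIV::'a set"] by auto
  then obtain x :: 'a where x: "x \<noteq> 0" by blast
  have "card {0, x, - x} \<le> 3" by (auto simp: card_insert_if)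
  then have "\<not> (UNIV::'a set) \<subseteq> {0, x, - x}"
    using card card_mono[of "{0, x, - x}" "UNIV::'a set"] by auto
  then obtain y where y: "y \<noteq> 0" "y \<noteq> x" "y \<noteq> - x" by blast
  have c0: "c \<noteq> 0" using c[OF x] q_nonzero[of x] by auto
  have "x + y \<noteq> 0" "x - y \<noteq> 0" using y by (auto simp: add_eq_0_iff minus_equation_iff)
  then have "c = b x y * c * c" "c * b x y = c * c"
    using q_add[of x y] q_diff[of x y] c x y by (auto simp: field_simps)
  then have cb: "b x y * c = 1" "b x y = c"
    using c0 by (metis mult_cancel_right mult_1_left, metis mult_cancel_left)
  have "x + x \<noteq> 0" using odd_card_double_eq_0[OF odd, of x] x by auto
  then have "c = c ^ 2 * c * c" using q_add[of x x] c x by (simp add: b_self)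
  then have "c = 1" using cb c0 by (simp add: power2_eq_square)
  then have "q z = 1" for z using c by (cases "z = 0") auto
  then have "b u z = 1" for u z by (simp add: bichar_def)
  then show False using mg x unfolding metric_group_def nondegenerate_def by blast
qed

end

subsection \<open>Finite quantum dilogarithms\<close>

locale quantum_dilog = finite_metric_group q for q :: "'a::{finite, ab_group_add} \<Rightarrow> complex" +
  fixes E :: "'a \<Rightarrow> complex" and r C :: complex
  assumes r_square: "r * r = of_nat CARD('a)"
    and C_nonzero: "C \<noteq> 0"
    and five_term: "b x y * E x * E y = C + 1 / r * (\<Sum>z\<in>UNIV. E (y - z) * E z * q z * E (x - z))"
begin

abbreviation h where "h \<equiv> fourier E"

section \<open>The five-term relation under the Fourier transform\<close>

definition Q :: "'a \<Rightarrow> 'a \<Rightarrow> complex" where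
  "Q y k = (\<Sum>z\<in>UNIV. E (y - z) * E z * q (z + k))"

lemma r_nonzero [simp]: "r \<noteq> 0"
  using r_square by auto

text \<open>Transform in \<open>x\<close> with \<open>y\<close> fixed: by orthogonality
  \<open>C\<close> survives only at \<open>k = 0\<close>, and the factor \<open>q k\<close> turns
  \<open>q z * b z k\<close> into \<open>q (z + k)\<close>.\<close>

lemma five_term_fourier:
  "r * E y * h (y + k) * q k = (if k = 0 then r * of_nat CARD('a) * C else 0) + h k * Q y k"
proof -
  define S where "S = (\<Sum>z\<in>UNIV. E (y - z) * E z * q z * b z k)"
  have shift: "(\<Sum>x\<in>UNIV. b x k * E (x - z)) = b z k * h k" for z
  proof -
    have "(\<Sum>x\<in>UNIV. b x k * E (x - z)) = (\<Sum>x\<in>UNIV. b (x + z) k * E (x + z - z))"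
      by (rule sum_UNIV_add[symmetric])
    then show ?thesis by (simp add: b_add_left fourier_def sum_distrib_left ac_simps)
  qed
  have "r * E y * h (y + k) = (\<Sum>x\<in>UNIV. b x k * (r * (b x y * E x * E y)))"
    by (simp add: fourier_def sum_distrib_left b_add_right ac_simps)
  also have "\<dots> = (\<Sum>x\<in>UNIV. b x k * (r * C) +
      b x k * (\<Sum>z\<in>UNIV. E (y - z) * E z * q z * E (x - z)))"
    by (intro sum.cong refl, subst five_term) (simp add: algebra_simps)
  also have "\<dots> = (\<Sum>x\<in>UNIV. b x k) * (r * C) +
      (\<Sum>x\<in>UNIV. \<Sum>z\<in>UNIV. E (y - z) * E z * q z * (b x k * E (x - z)))"
    by (simp add: sum.distrib sum_distrib_left sum_distrib_right ac_simps)
  also have "(\<Sum>x\<in>UNIV. \<Sum>z\<in>UNIV. E (y - z) * E z * q z * (b x k * E (x - z))) =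
      (\<Sum>z\<in>UNIV. E (y - z) * E z * q z * (b z k * h k))"
    by (subst sum.swap) (simp add: sum_distrib_left[symmetric] shift)
  also have "\<dots> = h k * S" by (simp add: S_def sum_distrib_left ac_simps)
  finally have *: "r * E y * h (y + k) =
      (if k = 0 then r * of_nat CARD('a) * C else 0) + h k * S"
    by (simp add: sum_bichar)
  have "S * q k = Q y k"
    by (simp add: S_def Q_def q_add sum_distrib_left sum_distrib_right ac_simps)
  then show ?thesis unfolding * by (auto simp: distrib_right ac_simps)
qed

lemma Q_symmetric: "Q y k = Q y (- y - k)"
proof -
  have "Q y k = (\<Sum>z\<in>UNIV. E (y - (y - z)) * E (y - z) * q (y - z + k))"
    unfolding Q_def by (rule sum_UNIV_diff[symmetric])
  moreover have "q (y - z + k) = q (z + (- y - k))" for z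
    using q_minus[of "y - z + k"] by (simp add: algebra_simps)
  ultimately show ?thesis by (simp add: Q_def mult.commute)
qed

lemma h_0_nonzero: "h 0 \<noteq> 0"
  using five_term_fourier[of 0 0] C_nonzero by auto

text \<open>Zeros of \<open>h\<close> propagate from \<open>k\<close> to \<open>y + k\<close>
  whenever \<open>E y\<close> is nonzero. Since \<open>h 0\<close> is not zero, neither one nor two
  such steps can lead from \<open>k\<close> to 0, so the five-term relation at
  \<open>(0, - k)\<close> loses every term but \<open>C\<close>.\<close>

lemma h_nonzero: "h k \<noteq> 0"
proof
  assume k: "h k = 0"
  have step: "h (y + k) = 0" if "h k = 0" "E y \<noteq> 0" for y k
    using five_term_fourier[of y k] that h_0_nonzero by (cases "k = 0") auto
  have "E (- k) = 0" using step[OF k, of "- k"] h_0_nonzero by auto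
  moreover have "E (- k - z) * E z = 0" for z
  proof (rule ccontr)
    assume "E (- k - z) * E z \<noteq> 0"
    then have "h (- k - z + (z + k)) = 0" by (intro step k) auto
    moreover have "- k - z + (z + k) = 0" by simp
    ultimately show False using h_0_nonzero by simp
  qed
  then have "(\<Sum>z\<in>UNIV. E (- k - z) * E z * q z * E (0 - z)) = 0"
    by (intro sum.neutral) simp
  ultimately show False using five_term[of 0 "- k"] C_nonzero by simp
qed

section \<open>The inversion relation and its constant\<close>

definition \<kappa> :: complex where "\<kappa> = - r * C / h 0"

lemma \<kappa>_nonzero: "\<kappa> \<noteq> 0"
  using C_nonzero h_0_nonzero by (simp add: \<kappa>_def)

text \<open>At \<open>y = 0\<close> the sum \<open>Q\<close> is \<open>q k\<close> times the
  transform of the left side, and \<open>h k\<close> cancels; the \<open>C\<close> term at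
  \<open>k = 0\<close> becomes the transform of the constant \<open>\<kappa>\<close>.\<close>

lemma E_reflect: "E x * E (- x) * q x = \<kappa> + (if x = 0 then r * E 0 else 0)"
proof (rule fourier_inject[of "\<lambda>x. E x * E (- x) * q x" "\<lambda>x. \<kappa> + (if x = 0 then r * E 0 else 0)"])
  fix k
  have "fourier (\<lambda>x. E x * E (- x) * q x) k * q k = Q 0 k"
    by (simp add: fourier_def Q_def q_add sum_distrib_left sum_distrib_right ac_simps)
  then have "r * E 0 * h k * q k = (if k = 0 then r * of_nat CARD('a) * C else 0) +
      h k * (fourier (\<lambda>x. E x * E (- x) * q x) k * q k)"
    using five_term_fourier[of 0 k] by simp
  then have "fourier (\<lambda>x. E x * E (- x) * q x) k =
      (if k = 0 then of_nat CARD('a) * \<kappa> else 0) + r * E 0"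
    using h_nonzero[of k] by (cases "k = 0") (simp_all add: \<kappa>_def field_simps)
  then show "fourier (\<lambda>x. E x * E (- x) * q x) k =
      fourier (\<lambda>x. \<kappa> + (if x = 0 then r * E 0 else 0)) k"
    by (simp only: fourier_const_delta)
qed

lemma E_0: "E 0 ^ 2 = r * E 0 + \<kappa>"
  using E_reflect[of 0] by (simp add: power2_eq_square)

lemma E_nonzero: "E x \<noteq> 0"
proof (cases "x = 0")
  case True
  then show ?thesis using E_0 \<kappa>_nonzero by auto
next
  case False
  then show ?thesis using E_reflect[of x] \<kappa>_nonzero by auto
qed

section \<open>The Fourier transform of \<open>E\<close> away from the origin\<close>

text \<open>Compares the two evaluations of \<open>Q y k = Q y (- y - k)\<close> with \<open>y = j - k\<close>.\<close>

lemma h_mult_h_minus: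
  assumes "k \<noteq> 0" "j \<noteq> 0"
  shows "h k * h (- k) / q k = h j * h (- j) / q j"
proof -
  define y where "y = j - k"
  have y: "y + k = j" "y + - j = - k" "- y - k = - j" by (simp_all add: y_def)
  have "r * E y * h j * q k = h k * Q y k"
    using five_term_fourier[of y k] assms(1) y(1) by simp
  moreover have "r * E y * h (- k) * q j = h (- j) * Q y k"
    using five_term_fourier[of y "- j"] assms(2) unfolding y(2) Q_symmetric[of y k] y(3) by simp
  ultimately have "(r * E y) * (h k * h (- k) * q j) = (r * E y) * (h j * h (- j) * q k)"
    by algebra
  then have "h k * h (- k) * q j = h j * h (- j) * q k"
    using E_nonzero[of y] by simp
  then show ?thesis by (simp add: field_simps)
qed

text \<open>The relation at \<open>k = 0\<close> gives the first form; at \<open>k = - y\<close>,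
  through \<open>Q_symmetric\<close>, it gives the second.\<close>

lemma Q_0:
  assumes "y \<noteq> 0"
  shows "Q y 0 = r * E y * h y / h 0 + of_nat CARD('a) * \<kappa>"
    and "Q y 0 = r * E y * h 0 * q y / h (- y)"
proof -
  show "Q y 0 = r * E y * h y / h 0 + of_nat CARD('a) * \<kappa>"
    using five_term_fourier[of y 0] h_0_nonzero by (simp add: \<kappa>_def field_simps)
  show "Q y 0 = r * E y * h 0 * q y / h (- y)"
    using five_term_fourier[of y "- y"] assms h_nonzero[of "- y"] Q_symmetric[of y 0]
    by (simp add: field_simps)
qed

text \<open>With \<open>h y * h (- y) = \<eta> * q y\<close>, equating the two forms of
  \<open>Q y 0\<close> is linear in \<open>h (- y)\<close>; \<open>c\<close> is the coefficient in
  its solution. The inversion relation identifies \<open>\<eta>\<close> as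
  \<open>\<kappa> * c ^ 2\<close>.\<close>

lemma h_reflect:
  assumes "CARD('a) > 1"
  obtains c where "c \<noteq> 0" "\<And>y. y \<noteq> 0 \<Longrightarrow> h y = c * q y * E (- y)"
    "r * \<kappa> * c * h 0 = h 0 ^ 2 - \<kappa> * c ^ 2"
proof -
  have "\<not> (UNIV::'a set) \<subseteq> {0}" using assms card_mono[of "{0}" "UNIV::'a set"] by auto
  then obtain a :: 'a where a: "a \<noteq> 0" by blast
  define \<eta> where "\<eta> = h a * h (- a) / q a"
  have \<eta>: "h y * h (- y) = \<eta> * q y" if "y \<noteq> 0" for y
    using h_mult_h_minus[OF that a] by (simp add: \<eta>_def field_simps)
  define c where "c = (h 0 ^ 2 - \<eta>) / (r * \<kappa> * h 0)"
  have "h (- y) = c * q y * E y" if "y \<noteq> 0" for y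
  proof -
    have "r * E y * h y / h 0 + r * r * \<kappa> = r * E y * h 0 * q y / h (- y)"
      using Q_0[OF that] r_square by simp
    then have "r * (E y * (h y * h (- y)) + r * \<kappa> * h 0 * h (- y)) = r * (E y * h 0 ^ 2 * q y)"
      using h_0_nonzero h_nonzero[of "- y"] by (simp add: field_simps power2_eq_square)
    then have "E y * (\<eta> * q y) + r * \<kappa> * h 0 * h (- y) = E y * h 0 ^ 2 * q y"
      unfolding \<eta>[OF that] by (simp only: mult_cancel_left r_nonzero simp_thms)
    then show ?thesis using h_0_nonzero \<kappa>_nonzero by (simp add: c_def field_simps)
  qed
  from this[of "- y" for y] have h: "h y = c * q y * E (- y)" if "y \<noteq> 0" for y
    using that by simp
  have c: "c \<noteq> 0" using h[OF a] h_nonzero[of a] by auto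
  have "\<eta> * q a = c ^ 2 * q a * (E a * E (- a) * q a)"
    using \<eta>[OF a] h[of a] h[of "- a"] a by (simp add: power2_eq_square ac_simps)
  also have "E a * E (- a) * q a = \<kappa>" using E_reflect[of a] a by simp
  finally have "\<eta> = \<kappa> * c ^ 2" by simp
  moreover have "r * \<kappa> * c * h 0 = h 0 ^ 2 - \<eta>"
    using h_0_nonzero \<kappa>_nonzero by (simp add: c_def)
  ultimately show ?thesis using that[OF c h] by simp
qed

text \<open>Small groups are settled by the normalisation. Otherwise two formulas for the transform
  of \<open>D\<close> leave two cases: \<open>h 0 = c * E 0\<close>, which gives the claim, or
  \<open>E\<close> constant off 0, which bounds the order by 3.\<close>

lemma \<kappa>_eq_1:
  assumes odd: "odd CARD('a)" and small: "CARD('a) \<le> 4 \<Longrightarrow> E 0 ^ 2 = r * E 0 + 1"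
  shows "\<kappa> = 1"
proof (cases "CARD('a) \<le> 4")
  case True
  then show ?thesis using small E_0 by simp
next
  case False
  then obtain c where c: "c \<noteq> 0" and h: "\<And>y. y \<noteq> 0 \<Longrightarrow> h y = c * q y * E (- y)"
    and c_eq: "r * \<kappa> * c * h 0 = h 0 ^ 2 - \<kappa> * c ^ 2"
    using h_reflect by auto
  define D where "D x = q x * E (- x)" for x
  \<comment> \<open>\<open>d\<close> is the excess of \<open>Q 0 0\<close> over the value shared by
    all \<open>Q (- k) k\<close> with \<open>k \<noteq> 0\<close>.\<close>
  define d where "d = r * (E 0 - c * \<kappa> / h 0)"
  have ED: "E x * D x = \<kappa>" if "x \<noteq> 0" for x
    using E_reflect[of x] that by (simp add: D_def ac_simps)
  have Q: "Q (- k) k = (r * c * \<kappa> / h 0 + of_nat CARD('a) * \<kappa>) + (if k = 0 then d else 0)" for k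
  proof (cases "k = 0")
    case True
    have "Q 0 0 = r * E 0 + of_nat CARD('a) * \<kappa>"
      using five_term_fourier[of 0 0] h_0_nonzero by (simp add: \<kappa>_def field_simps)
    then show ?thesis using True by (simp add: d_def algebra_simps)
  next
    case False
    then have "Q (- k) 0 = r * c * (E (- k) * D (- k)) / h 0 + of_nat CARD('a) * \<kappa>"
      using Q_0(1)[of "- k"] h[of "- k"] by (simp add: D_def ac_simps)
    then show ?thesis using False ED[of "- k"] Q_symmetric[of "- k" k] by simp
  qed
  \<comment> \<open>\<open>Q (- k) k\<close> is a correlation of \<open>E\<close> with
    \<open>D\<close>, so its transform factors.\<close>
  have FQ: "fourier (\<lambda>k. Q (- k) k) j = fourier D j * h (- j)" for j
  proof -
    have shift: "(\<Sum>k\<in>UNIV. b k j * D (z + k)) = b (- z) j * fourier D j" for z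
    proof -
      have "(\<Sum>k\<in>UNIV. b k j * D (z + k)) = (\<Sum>k\<in>UNIV. b (k + - z) j * D (z + (k + - z)))"
        by (rule sum_UNIV_add[symmetric])
      also have "\<dots> = (\<Sum>k\<in>UNIV. b (- z) j * (b k j * D k))"
        unfolding b_add_left by (intro sum.cong) (simp_all add: mult.commute mult.assoc)
      finally show ?thesis by (simp add: fourier_def sum_distrib_left)
    qed
    have "fourier (\<lambda>k. Q (- k) k) j = (\<Sum>k\<in>UNIV. \<Sum>z\<in>UNIV. E z * (b k j * D (z + k)))"
      by (simp add: fourier_def Q_def D_def sum_distrib_left algebra_simps)
    also have "\<dots> = (\<Sum>z\<in>UNIV. E z * (b (- z) j * fourier D j))"
      by (subst sum.swap) (simp add: sum_distrib_left[symmetric] shift)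
    also have "\<dots> = fourier D j * (\<Sum>z\<in>UNIV. b z (- j) * E z)"
      by (simp add: sum_distrib_left b_minus_left b_minus_right ac_simps)
    finally show ?thesis by (simp add: fourier_def)
  qed
  have D_hat: "fourier D j * c * \<kappa> = d * E (- j)" if "j \<noteq> 0" for j
  proof -
    have "fourier D j * h (- j) = d"
      unfolding FQ[symmetric] Q fourier_const_delta using that by simp
    then have "fourier D j * c * (E (- j) * D (- j)) = d * E (- j)"
      using h[of "- j"] that by (auto simp: D_def ac_simps)
    then show ?thesis using ED[of "- j"] that by simp
  qed
  \<comment> \<open>Away from 0 \<open>h\<close> is \<open>c * D\<close>; transforming once more
    returns \<open>E\<close>.\<close>
  have E_hat: "r * r * E (- j) = c * fourier D j + (h 0 - c * E 0)" for j
  proof -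
    have "h k = c * D k + (if k = 0 then h 0 - c * E 0 else 0)" for k
      using h[of k] by (cases "k = 0") (simp_all add: D_def)
    then have "fourier h j = fourier (\<lambda>k. c * D k + (if k = 0 then h 0 - c * E 0 else 0)) j"
      by (intro arg_cong[of _ _ "\<lambda>f. fourier f j"] ext)
    also have "\<dots> = (\<Sum>k\<in>UNIV. c * (b k j * D k) + (if k = 0 then h 0 - c * E 0 else 0))"
      unfolding fourier_def by (intro sum.cong) (auto simp: algebra_simps)
    also have "\<dots> = c * fourier D j + (h 0 - c * E 0)"
      by (simp add: sum.distrib sum_distrib_left fourier_def)
    finally show ?thesis by (simp add: fourier_fourier r_square)
  qed
  \<comment> \<open>Once the transform of \<open>D\<close> is eliminated, \<open>c_eq\<close> makes
    the remaining equation factor.\<close>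
  have dichotomy: "(h 0 - c * E 0) * (r * E (- j) - c * \<kappa>) = 0" if "j \<noteq> 0" for j
  proof -
    have "r * r * \<kappa> * E (- j) = d * E (- j) + \<kappa> * (h 0 - c * E 0)"
      using E_hat[of j] D_hat[OF that] by algebra
    then have "r * r * \<kappa> * h 0 * E (- j)
        = r * (E 0 * h 0 - c * \<kappa>) * E (- j) + \<kappa> * h 0 * (h 0 - c * E 0)"
      using h_0_nonzero by (simp add: d_def field_simps)
    then have "h 0 * ((h 0 - c * E 0) * (r * E (- j) - c * \<kappa>)) = 0"
      using c_eq by algebra
    then show ?thesis using h_0_nonzero by simp
  qed
  show ?thesis
  proof (cases "h 0 = c * E 0")
    case True
    then have "c * c * (r * \<kappa> * E 0) = c * c * (E 0 ^ 2 - \<kappa>)"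
      using c_eq by (simp add: power2_eq_square algebra_simps)
    then have "r * \<kappa> * E 0 = r * E 0" using c E_0 by simp
    then show ?thesis using E_nonzero[of 0] by simp
  next
    case False
    then have E: "E j = c * \<kappa> / r" if "j \<noteq> 0" for j
      using dichotomy[of "- j"] that False by (auto simp: eq_divide_eq mult.commute)
    have "q x = \<kappa> / (c * \<kappa> / r * (c * \<kappa> / r))" if "x \<noteq> 0" for x
      using E_reflect[of x] E[of x] E[of "- x"] that c \<kappa>_nonzero by (simp add: field_simps)
    then show ?thesis using card_le_3_if_q_const[OF odd] \<open>\<not> CARD('a) \<le> 4\<close> by fastforce
  qed
qed

text \<open>At \<open>y = a + a\<close>, \<open>k = - a\<close> the values of \<open>h\<close> turn
  into values of \<open>E\<close> and the common factor \<open>c * q a\<close> cancels. Odd order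
  makes \<open>a\<close> the only fixed point of the pairing, with term
  \<open>E a ^ 2\<close>.\<close>

lemma cube_congruence:
  assumes odd: "odd CARD('a)" and a: "a \<noteq> 0"
  shows "\<exists>B. r * E (a + a) * E (- a) * q a =
    E a * (E a ^ 2 + 2 * (\<Sum>z\<in>B. E (a + a - z) * E z * q (z - a)))"
proof -
  have "card {0, a} \<le> CARD('a)" by (rule card_mono) auto
  then have "CARD('a) > 1" using a by simp
  then obtain c where c: "c \<noteq> 0" and h: "\<And>y. y \<noteq> 0 \<Longrightarrow> h y = c * q y * E (- y)"
    using h_reflect by metis
  let ?f = "\<lambda>z. E (a + a - z) * E z * q (z - a)"
  have "c * q a * (r * E (a + a) * E (- a) * q a) = c * q a * (E a * Q (a + a) (- a))"
    using five_term_fourier[of "a + a" "- a"] h[of a] h[of "- a"] a by (simp add: ac_simps)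
  then have "r * E (a + a) * E (- a) * q a = E a * Q (a + a) (- a)" using c by simp
  also have "Q (a + a) (- a) = ?f a + sum ?f (UNIV - {a})"
    by (subst sum.remove[symmetric]) (auto simp: Q_def)
  also have "?f a = E a ^ 2" by (simp add: power2_eq_square)
  finally have *: "r * E (a + a) * E (- a) * q a = E a * (E a ^ 2 + sum ?f (UNIV - {a}))" .
  have "\<exists>B\<subseteq>UNIV - {a}. sum ?f (UNIV - {a}) = 2 * sum ?f B"
  proof (rule sum_involution[where i = "\<lambda>z. a + a - z"])
    fix z assume z: "z \<in> UNIV - {a}"
    have "a + a - z \<noteq> z"
    proof
      assume "a + a - z = z"
      then have "(a - z) + (a - z) = 0" by (simp add: algebra_simps)
      then show False using odd_card_double_eq_0[OF odd, of "a - z"] z by simp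
    qed
    moreover have "a + a - z \<noteq> a" using z by (auto simp: algebra_simps)
    ultimately show "a + a - z \<in> UNIV - {a} \<and> a + a - z \<noteq> z \<and> a + a - (a + a - z) = z"
      by simp
    show "?f (a + a - z) = ?f z" using q_minus[of "z - a"] by (simp add: ac_simps)
  qed simp
  then show ?thesis using * by auto
qed

end

subsection \<open>Algebraic numbers\<close>

text \<open>
  Algebraic numbers are closed under sums and products because they are the numbers whose powers
  all lie in one finite-dimensional rational subspace.
\<close>

interpretation rat_vs: vector_space "\<lambda>(c::rat) (x::complex). of_rat c * x"
  by standard (auto simp: algebra_simps of_rat_add of_rat_mult)

text \<open>Linear dependence concerns the set of powers, so a coincidence
  \<open>z ^ i = z ^ j\<close> is treated apart. Infinitely many distinct powers in a finitely
  generated span are dependent, and the dependence is a polynomial equation.\<close>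

lemma algebraic_if_powers_in_span:
  assumes fin: "finite B" and pow: "\<And>k. z ^ k \<in> rat_vs.span B"
  shows "algebraic z"
proof (cases "inj (\<lambda>k::nat. z ^ k)")
  case False
  then obtain i j where ij: "i < j" "z ^ i = z ^ j"
    unfolding inj_def by (metis linorder_neqE_nat)
  define p :: "complex poly" where "p = monom 1 j - monom 1 i"
  have "coeff p j \<noteq> 0" using ij by (simp add: p_def)
  then have "p \<noteq> 0" by auto
  moreover have "poly p z = 0" using ij by (simp add: p_def poly_monom)
  moreover have "coeff p k \<in> \<int>" for k by (simp add: p_def)
  ultimately show ?thesis by (intro algebraicI)
next
  case True
  then have "infinite (range (\<lambda>k::nat. z ^ k))" by (simp add: range_inj_infinite)
  moreover have "range (\<lambda>k::nat. z ^ k) \<subseteq> rat_vs.span B" using pow by auto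
  ultimately have "rat_vs.dependent (range (\<lambda>k::nat. z ^ k))"
    using rat_vs.independent_span_bound[OF fin] by blast
  then obtain t u v where t: "finite t" "t \<subseteq> range (\<lambda>k::nat. z ^ k)"
    "(\<Sum>v\<in>t. of_rat (u v) * v) = 0" "v \<in> t" "u v \<noteq> 0"
    unfolding rat_vs.dependent_explicit by blast
  define K where "K = (\<lambda>k::nat. z ^ k) -` t"
  have finK: "finite K" unfolding K_def using t(1) True by (rule finite_vimageI)
  have tK: "t = (\<lambda>k. z ^ k) ` K" unfolding K_def using t(2) by auto
  define p :: "complex poly" where "p = (\<Sum>k\<in>K. monom (of_rat (u (z ^ k))) k)"
  have cf: "coeff p i = (if i \<in> K then of_rat (u (z ^ i)) else 0)" for i
    unfolding p_def coeff_sum by (simp add: finK if_distrib sum.delta cong: if_cong)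
  obtain i where "i \<in> K" "v = z ^ i" using t(4) tK by auto
  then have "coeff p i \<noteq> 0" using t(5) by (simp add: cf)
  then have "p \<noteq> 0" by auto
  moreover have "poly p z = 0"
  proof -
    have "inj_on (\<lambda>k. z ^ k) K" using True by (rule inj_on_subset) simp
    then have "(\<Sum>v\<in>t. of_rat (u v) * v) = (\<Sum>k\<in>K. of_rat (u (z ^ k)) * z ^ k)"
      unfolding tK by (simp add: sum.reindex)
    then show ?thesis using t(3) by (simp add: p_def poly_sum poly_monom)
  qed
  moreover have "coeff p i \<in> \<rat>" for i by (simp add: cf)
  ultimately show ?thesis by (intro algebraicI')
qed

text \<open>A rational polynomial equation is solved for its leading power; \<open>m\<close> is the
  degree.\<close>

lemma algebraic_imp_power_in_span:
  assumes "algebraic (x::complex)"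
  obtains m where "x ^ m \<in> rat_vs.span ((\<lambda>i. x ^ i) ` {..<m})"
proof -
  from assms obtain p where p: "\<And>i. coeff p i \<in> \<rat>" "p \<noteq> 0" "poly p x = 0"
    unfolding algebraic_altdef by blast
  define m where "m = degree p"
  have "\<forall>i. \<exists>c. coeff p i = of_rat c" using p(1) by (auto elim: Rats_cases)
  then obtain c where c: "\<And>i. coeff p i = of_rat (c i)" by metis
  have cm: "c m \<noteq> 0" using p(2) c[of m] by (auto simp: m_def)
  have "0 = (\<Sum>i\<le>m. coeff p i * x ^ i)" using p(3) by (simp add: poly_altdef m_def)
  also have "\<dots> = (\<Sum>i<m. of_rat (c i) * x ^ i) + of_rat (c m) * x ^ m"
    by (simp add: c lessThan_Suc_atMost[symmetric])
  finally have "of_rat (c m) * x ^ m = (\<Sum>i<m. of_rat (- c i) * x ^ i)"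
    by (simp add: of_rat_minus sum_negf eq_neg_iff_add_eq_0 add.commute)
  also have "\<dots> \<in> rat_vs.span ((\<lambda>i. x ^ i) ` {..<m})"
    by (intro rat_vs.span_sum rat_vs.span_scale rat_vs.span_base) auto
  finally have "of_rat (inverse (c m)) * (of_rat (c m) * x ^ m) \<in> rat_vs.span ((\<lambda>i. x ^ i) ` {..<m})"
    by (rule rat_vs.span_scale)
  moreover have "of_rat (inverse (c m)) * (of_rat (c m) * x ^ m) = x ^ m"
    using cm by (simp add: of_rat_inverse mult.assoc[symmetric])
  ultimately show ?thesis by (intro that[of m]) (rule subst)
qed

lemma mult_in_span:
  assumes "\<And>v. v \<in> B \<Longrightarrow> a * v \<in> rat_vs.span B'" and "w \<in> rat_vs.span B"
  shows "a * w \<in> rat_vs.span B'"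
  using assms(2)
proof (induction rule: rat_vs.span_induct_alt)
  case base
  then show ?case by (simp add: rat_vs.span_zero)
next
  case (step c u w)
  have "a * (of_rat c * u + w) = of_rat c * (a * u) + a * w" by (simp add: algebra_simps)
  then show ?case using step assms(1) by (simp add: rat_vs.span_add rat_vs.span_scale)
qed

lemma
  assumes "algebraic x" and "algebraic (y::complex)"
  shows algebraic_add: "algebraic (x + y)" and algebraic_mult: "algebraic (x * y)"
proof -
  obtain m where m: "x ^ m \<in> rat_vs.span ((\<lambda>i. x ^ i) ` {..<m})"
    using algebraic_imp_power_in_span[OF assms(1)] .
  obtain n where n: "y ^ n \<in> rat_vs.span ((\<lambda>i. y ^ i) ` {..<n})"
    using algebraic_imp_power_in_span[OF assms(2)] .
  \<comment> \<open>The span of the empty set is 0, which does not contain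
    \<open>x ^ 0 = 1\<close>.\<close>
  have mn: "m > 0" "n > 0" using m n by (auto intro!: Nat.gr0I)
  define B where "B = (\<lambda>(i, j). x ^ i * y ^ j) ` ({..<m} \<times> {..<n})"
  have B: "x ^ i * y ^ j \<in> rat_vs.span B" if "i < m" "j < n" for i j
    using that by (intro rat_vs.span_base) (auto simp: B_def)
  have xB: "x * w \<in> rat_vs.span B" if "w \<in> rat_vs.span B" for w
  proof (rule mult_in_span[OF _ that])
    fix v assume "v \<in> B"
    then obtain i j where ij: "i < m" "j < n" "v = x ^ i * y ^ j" by (auto simp: B_def)
    have "y ^ j * x ^ Suc i \<in> rat_vs.span B"
    \<comment> \<open>Only the top exponent leaves the range of \<open>B\<close>; there
      \<open>x ^ m\<close> is rewritten by lower powers.\<close>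
    proof (cases "Suc i = m")
      case True
      show ?thesis unfolding True
        by (rule mult_in_span[OF _ m]) (use B ij in \<open>auto simp: mult.commute\<close>)
    next
      case False
      then show ?thesis using B[of "Suc i" j] ij by (simp add: ac_simps)
    qed
    then show "x * v \<in> rat_vs.span B" using ij by (simp add: ac_simps)
  qed
  have yB: "y * w \<in> rat_vs.span B" if "w \<in> rat_vs.span B" for w
  proof (rule mult_in_span[OF _ that])
    fix v assume "v \<in> B"
    then obtain i j where ij: "i < m" "j < n" "v = x ^ i * y ^ j" by (auto simp: B_def)
    have "x ^ i * y ^ Suc j \<in> rat_vs.span B"
    proof (cases "Suc j = n")
      case True
      show ?thesis unfolding True
        by (rule mult_in_span[OF _ n]) (use B ij in auto)
    next
      case False
      then show ?thesis using B[of i "Suc j"] ij by (simp add: ac_simps)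
    qed
    then show "y * v \<in> rat_vs.span B" using ij by (simp add: ac_simps)
  qed
  have fin: "finite B" by (simp add: B_def)
  have one: "1 \<in> rat_vs.span B" using B[of 0 0] mn by simp
  have "(x + y) ^ k \<in> rat_vs.span B" for k
    by (induction k) (auto simp: one distrib_right intro!: rat_vs.span_add xB yB)
  then show "algebraic (x + y)" by (rule algebraic_if_powers_in_span[OF fin])
  have "(x * y) ^ k \<in> rat_vs.span B" for k
    by (induction k) (auto simp: one mult.assoc intro!: xB yB)
  then show "algebraic (x * y)" by (rule algebraic_if_powers_in_span[OF fin])
qed

lemma algebraic_sum:
  "(\<And>i. i \<in> A \<Longrightarrow> algebraic (f i :: complex)) \<Longrightarrow> algebraic (sum f A)"
  by (induction A rule: infinite_finite_induct) (auto intro: algebraic_add)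

lemma algebraic_root_of_unity:
  assumes "(x::complex) ^ m = 1" "m > 0"
  shows "algebraic x"
proof -
  have "coeff (monom 1 m - 1 :: complex poly) m \<noteq> 0" using assms by (simp add: coeff_1)
  then have "monom 1 m - 1 \<noteq> (0 :: complex poly)" by (metis coeff_0)
  then show ?thesis using assms
    by (intro algebraicI[of "monom 1 m - 1"]) (auto simp: poly_monom coeff_1)
qed

subsection \<open>Valuations\<close>

locale valuation_above_2 =
  fixes v :: "complex \<Rightarrow> ereal"
  assumes val: "valuation_on_algebraic v" and ext: "extends_padic_val 2 v"
begin

lemma v_mult: "algebraic x \<Longrightarrow> algebraic y \<Longrightarrow> v (x * y) = v x + v y"
  using val by (simp add: valuation_on_algebraic_def)

lemma v_add: "algebraic x \<Longrightarrow> algebraic y \<Longrightarrow> v (x + y) \<ge> min (v x) (v y)"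
  using val by (simp add: valuation_on_algebraic_def)

lemma v_0: "v 0 = \<infinity>"
  using val by (simp add: valuation_on_algebraic_def)

lemma v_finite: "algebraic x \<Longrightarrow> x \<noteq> 0 \<Longrightarrow> \<bar>v x\<bar> \<noteq> \<infinity>"
  using val by (auto simp: valuation_on_algebraic_def)

lemma v_of_nat: "m \<noteq> 0 \<Longrightarrow> v (of_nat m) = ereal (real (multiplicity 2 (int m)))"
proof -
  assume m: "m \<noteq> 0"
  have "quotient_of (of_int (int m)) = (int m, 1)"
    using quotient_of_int[of "int m"] by (simp add: Rat.of_int_def)
  then have "padic_val 2 (of_nat m) = ereal (real (multiplicity 2 (int m)))"
    using m by (simp add: padic_val_def)
  moreover have "v (of_rat (of_nat m)) = padic_val 2 (of_nat m)"
    using ext unfolding extends_padic_val_def by blast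
  ultimately show ?thesis by simp
qed

lemma v_odd: "odd m \<Longrightarrow> v (of_nat m) = 0"
  by (subst v_of_nat) (auto simp: not_dvd_imp_multiplicity_0 zero_ereal_def odd_pos)

lemma v_1: "v 1 = 0"
  using v_odd[of 1] by simp

lemma v_2: "v 2 = 1"
  using v_of_nat[of 2] by (simp add: one_ereal_def)

text \<open>\<open>v (x ^ k)\<close> is \<open>k\<close> times a real number \<open>w\<close>, so
  \<open>m * w = 0\<close> forces \<open>w = 0\<close>.\<close>

lemma v_root_of_unity:
  assumes "x ^ m = 1" "m > 0"
  shows "v x = 0"
proof -
  have alg: "algebraic x" using assms by (rule algebraic_root_of_unity)
  have alg_pow: "algebraic (x ^ k)" for k
    by (induction k) (auto intro: algebraic_mult alg rat_imp_algebraic)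
  have "x \<noteq> 0" using assms by (auto simp: power_0_left)
  then obtain w where w: "v x = ereal w" using v_finite[OF alg] by (cases "v x") auto
  have "v (x ^ k) = ereal (real k * w)" for k
    by (induction k) (auto simp: v_1 v_mult alg alg_pow w algebra_simps zero_ereal_def)
  then show ?thesis using assms w v_1 by (metis ereal_eq_0(2) mult_eq_0_iff of_nat_eq_0_iff less_irrefl)
qed

lemma v_minus: "algebraic x \<Longrightarrow> v (- x) = v x"
  using v_mult[of "- 1" x] v_root_of_unity[of "- 1" 2] by (simp add: rat_imp_algebraic)

lemma v_sum:
  assumes "\<And>i. i \<in> A \<Longrightarrow> algebraic (f i)" "\<And>i. i \<in> A \<Longrightarrow> v (f i) \<ge> c"
  shows "v (sum f A) \<ge> c"
  using assms
proof (induction A rule: infinite_finite_induct)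
  case (insert i A)
  have "v (f i + sum f A) \<ge> min (v (f i)) (v (sum f A))"
    using insert by (intro v_add algebraic_sum) auto
  then show ?case using insert by (auto simp: min_def split: if_splits intro: order_trans)
\<comment> \<open>Over empty and infinite index sets the sum is 0, of valuation
  \<open>\<infinity>\<close>.\<close>
qed (auto simp: v_0)

section \<open>Integrality of the values of \<open>E\<close>, then units\<close>

lemma v_dilog_eq_0:
  fixes q :: "'a::{finite, ab_group_add} \<Rightarrow> complex"
  assumes "quantum_dilog q E r C" and odd: "odd CARD('a)" and alg_E: "\<And>u. algebraic (E u)"
    and small: "CARD('a) \<le> 4 \<Longrightarrow> E 0 ^ 2 = r * E 0 + 1"
  shows "v (E u) = 0"
proof -
  interpret quantum_dilog q E r C by fact
  have \<kappa>: "\<kappa> = 1" by (rule \<kappa>_eq_1[OF odd small])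
  have alg_r: "algebraic r"
    using algebraic_root[of "of_nat CARD('a)" "monom 1 2" r] r_square
    by (simp add: poly_monom power2_eq_square rat_imp_algebraic degree_monom_eq)
  have alg_q: "algebraic (q x)" and v_q: "v (q x) = 0" for x
    using q_root_of_unity[of x] algebraic_root_of_unity v_root_of_unity by blast+
  note alg = algebraic_mult algebraic_add algebraic_sum algebraic_minus alg_E alg_r alg_q
    rat_imp_algebraic
  have "v r + v r = 0"
    using v_mult[OF alg_r alg_r] v_odd[OF odd] by (simp add: r_square)
  then have v_r: "v r = 0" by (cases "v r") auto
  obtain e where e: "v (E u) = ereal (e u)" for u
    using v_finite[OF alg_E E_nonzero] that[of "\<lambda>u. real_of_ereal (v (E u))"]
    by (simp add: ereal_real)
  have E0: "E 0 * E 0 = r * E 0 + 1" using E_0 \<kappa> by (simp add: power2_eq_square)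
  have "v (r * E 0 + 1) \<ge> min (v (r * E 0)) (v 1)" by (intro v_add alg) auto
  \<comment> \<open>A negative \<open>e 0\<close> would have to satisfy
    \<open>e 0 + e 0 \<ge> e 0\<close>, which is impossible.\<close>
  then have "ereal (e 0 + e 0) \<ge> min (ereal (e 0)) 0"
    unfolding E0[symmetric] by (simp add: v_mult alg v_r v_1 e)
  then have e0: "e 0 \<ge> 0" by (auto simp: min_def zero_ereal_def split: if_splits)
  have nonneg: "e u \<ge> 0" for u
  proof -
    obtain a where a: "\<And>u. e a \<le> e u"
      using ex_min_if_finite[of "range e"] by (auto simp: not_less)
    have "e a \<ge> 0"
    proof (rule ccontr)
      assume neg: "\<not> e a \<ge> 0"
      then have "a \<noteq> 0" using e0 by auto
      then obtain B where B: "r * E (a + a) * E (- a) * q a =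
          E a * (E a ^ 2 + 2 * (\<Sum>z\<in>B. E (a + a - z) * E z * q (z - a)))"
        using cube_congruence[OF odd] by blast
      define S where "S = (\<Sum>z\<in>B. E (a + a - z) * E z * q (z - a))"
      have alg_S: "algebraic S" unfolding S_def by (intro alg)
      have "v S \<ge> ereal (e a + e a)"
        unfolding S_def using add_mono[OF a a]
        by (intro v_sum) (simp_all add: v_mult alg v_q e)
      then have "ereal (1 + e a) + v S \<ge> ereal (1 + e a) + ereal (e a + e a)"
        by (rule add_left_mono)
      \<comment> \<open>The summand 1 is \<open>v 2\<close>; it keeps this term strictly above the
        valuation of the cube.\<close>
      moreover have "v (2 * E a * S) = ereal (1 + e a) + v S"
        by (simp add: v_mult alg alg_S v_2 e one_ereal_def)
      ultimately have "v (- (2 * E a * S)) \<ge> ereal (1 + 3 * e a)"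
        by (simp add: v_minus alg alg_S add.commute)
      moreover have "v (r * E (a + a) * E (- a) * q a) \<ge> ereal (2 * e a)"
        using add_mono[OF a[of "a + a"] a[of "- a"]] by (simp add: v_mult alg v_r v_q e)
      moreover have "E a * E a * E a = r * E (a + a) * E (- a) * q a + - (2 * E a * S)"
        using B by (simp add: S_def algebra_simps power2_eq_square)
      moreover have "v (r * E (a + a) * E (- a) * q a + - (2 * E a * S))
          \<ge> min (v (r * E (a + a) * E (- a) * q a)) (v (- (2 * E a * S)))"
        by (intro v_add alg alg_S) auto
      ultimately have "v (E a * E a * E a) \<ge> min (ereal (2 * e a)) (ereal (1 + 3 * e a))"
        by (auto intro: order_trans[OF min.mono])
      \<comment> \<open>For negative \<open>e a\<close> both \<open>2 * e a\<close> and
        \<open>1 + 3 * e a\<close> exceed \<open>3 * e a\<close>.\<close>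
      then have "3 * e a \<ge> min (2 * e a) (1 + 3 * e a)"
        by (simp add: v_mult alg e min_def split: if_splits)
      then show False using neg by (auto simp: min_def split: if_splits)
    qed
    then show ?thesis using a[of u] by simp
  qed
  show ?thesis
  proof (cases "u = 0")
    case True
    \<comment> \<open>The quadratic equation exhibits the inverse of \<open>E 0\<close>, which is
      again integral.\<close>
    have "E 0 * (E 0 + - r) = 1" using E0 by (simp add: algebra_simps)
    moreover have "algebraic (E 0 + - r)" by (intro alg)
    ultimately have "v (E 0) + v (E 0 + - r) = 0"
      using v_mult[of "E 0" "E 0 + - r"] by (simp only: alg_E v_1)
    moreover have "v (E 0 + - r) \<ge> min (v (E 0)) (v (- r))" by (intro v_add alg)
    then have "v (E 0 + - r) \<ge> 0" using e0
      by (simp add: v_minus alg v_r e zero_ereal_def min_def split: if_splits)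
    ultimately show ?thesis using e0 True e[of 0]
      by (cases "v (E 0 + - r)") (auto simp: zero_ereal_def)
  next
    case False
    \<comment> \<open>As \<open>\<kappa> = 1\<close>, the integral numbers \<open>E u\<close> and
      \<open>E (- u)\<close> have a unit as product.\<close>
    then have "v (E u * E (- u) * q u) = 0" using E_reflect[of u] \<kappa> v_1 by simp
    then have "e u + e (- u) = 0" by (simp add: v_mult alg v_q e zero_ereal_def)
    then show ?thesis using nonneg[of u] nonneg[of "- u"] e[of u] by (simp add: zero_ereal_def)
  qed
qed

end

theorem theorem10:
  fixes q :: "'a::{finite, ab_group_add} \<Rightarrow> complex"
    and E :: "'a \<Rightarrow> complex"
  assumes "metric_group q"
    and "odd CARD('a)"
    and "\<And>u. algebraic (E u)"
    and "finite_quantum_dilog q E"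
  shows "\<forall>u v. valuation_on_algebraic v \<and> extends_padic_val 2 v \<longrightarrow> v (E u) = 0"
proof (intro allI impI)
  fix u v
  assume v: "valuation_on_algebraic v \<and> extends_padic_val 2 v"
  define r where "r = complex_of_real (sqrt (real CARD('a)))"
  obtain C where "C \<noteq> 0" and five_term: "\<And>x y. bichar q x y * E x * E y =
      C + 1 / r * (\<Sum>z\<in>UNIV. E (y - z) * E z * q z * E (x - z))"
    and small: "CARD('a) \<le> 4 \<Longrightarrow> E 0 ^ 2 = r * E 0 + 1"
    using assms(4) unfolding finite_quantum_dilog_def r_def by blast
  moreover have "r * r = of_nat CARD('a)"
    by (simp add: r_def flip: of_real_mult)
  ultimately have "quantum_dilog q E r C"
    using assms(1) by unfold_locales auto
  moreover have "valuation_above_2 v" using v by unfold_locales auto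
  ultimately show "v (E u) = 0"
    using assms(2,3) small by (blast intro: valuation_above_2.v_dilog_eq_0)
qed

end
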